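(* Let $\Lambda$ be a numerical semigroup of embedding dimension $n\ge 2$ and let $I$ be an irreducible ideal of $\Lambda$. Then the graph $G_I(\Lambda)$ is planar if one of the following holds: (1) $|G_I(\Lambda)|\le 5$; (2) $|G_I(\Lambda)|=6$ and $G_I(\Lambda)$ is isomorphic to one of the graphs $H_1,H_2,H_3,H_4$; (3) $|G_I(\Lambda)|=7$ and $G_I(\Lambda)$ is isomorphic to one of the graphs $K_1,K_2,K_3$. Here $H_1,\dots,H_4$ and $K_1,K_2,K_3$ are the explicit graphs listed in the context.
   Context: A numerical semigroup is a submonoid $\Lambda$ of $(\mathbb{Z}_{\ge 0},+)$ with finite complement; its embedding dimension is the cardinality of its minimal system of generators. An ideal of $\Lambda$ is a nonempty subset $I\subset\Lambda$ with $I+\Lambda\subset I$. It is irreducible if it is a proper ideal that cannot be written as an intersection of two or more proper ideals each properly containing it. (Known fact, due to Barucci: every irreducible ideal of $\Lambda$ has the form $\Lambda\setminus B(x)$ for some $x\in\Lambda$, where $B(x)=\{y\in\Lambda: x-y\in\Lambda\}$.) The graph $G_I(\Lambda)$ is the simple graph with vertex set $\{v_i : i\in(\Lambda\setminus I)\setminus\{0\}\}$ in which distinct vertices $v_i,v_j$ are adjacent if and only if $i+j\in I$. $|G|$ denotes the order (number of vertices) of $G$. Graphs of order 6, on vertex set $\{1,\dots,6\}$ ($ij$ denotes the edge $\{i,j\}$): $H_1$: $12,23,24,25,26,34,36,46,56$. $H_2$: $12,15,23,24,25,26,35,36,45,46,56$. $H_3$: $12,15,23,24,25,26,34,35,36,45,46$.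 $H_4$: $12,13,14,15,16,23,24,25,26,36,45,46$. Graphs of order 7, on vertex set $\{1,\dots,7\}$: $K_1$: $12,13,14,15,16,17,24,25,26,27,47,57$. In $K_2$ and $K_3$ the vertex $3$ is adjacent to all other vertices, and the remaining edges are: $K_2$: $12,15,16,17,26,27,46,56$. $K_3$: $12,15,16,17,24,26,27,47,57$. *)

theory Defs
  imports "HOL-Analysis.Analysis"
begin

definition add_submonoid :: "nat set \<Rightarrow> bool" where
  "add_submonoid S \<longleftrightarrow> 0 \<in> S \<and> (\<forall>x\<in>S. \<forall>y\<in>S. x + y \<in> S)"

definition numerical_semigroup :: "nat set \<Rightarrow> bool" where
  "numerical_semigroup \<Lambda> \<longleftrightarrow> add_submonoid \<Lambda> \<and> finite (- \<Lambda>)"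

definition generates :: "nat set \<Rightarrow> nat set \<Rightarrow> bool" where
  "generates A \<Lambda> \<longleftrightarrow> add_submonoid hull A = \<Lambda>"

definition minimal_generators :: "nat set \<Rightarrow> nat set \<Rightarrow> bool" where
  "minimal_generators A \<Lambda> \<longleftrightarrow> generates A \<Lambda> \<and> (\<forall>B. B \<subset> A \<longrightarrow> \<not> generates B \<Lambda>)"

text \<open>The description operator is justified by \<open>ex1_minimal_generators\<close> below; the minimal
  system of generators is finite by \<open>finite_minimal_generators\<close>, so \<^term>\<open>card\<close> is its true
  cardinality.\<close>

definition embedding_dimension :: "nat set \<Rightarrow> nat" where
  "embedding_dimension \<Lambda> = card (THE A. minimal_generators A \<Lambda>)"

lemma add_submonoid_hull: "add_submonoid (add_submonoid hull A)"
  by (rule hull_in) (auto simp: add_submonoid_def)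

lemma minimal_generators_iff:
  assumes "numerical_semigroup \<Lambda>"
  shows "minimal_generators A \<Lambda> \<longleftrightarrow>
    A = {x \<in> \<Lambda> - {0}. \<not> (\<exists>a\<in>\<Lambda> - {0}. \<exists>b\<in>\<Lambda> - {0}. x = a + b)}" (is "_ \<longleftrightarrow> A = ?P")
proof -
  have sub: "add_submonoid \<Lambda>" using assms by (simp add: numerical_semigroup_def)
  have least: "?P \<subseteq> B" if B: "generates B \<Lambda>" for B
  proof
    fix x assume x: "x \<in> ?P"
    have BL: "B \<subseteq> \<Lambda>" using B hull_subset[of B add_submonoid] by (simp add: generates_def)
    have "add_submonoid (\<Lambda> - {x})"
      unfolding add_submonoid_def
    proof (intro conjI ballI)
      show "0 \<in> \<Lambda> - {x}" using sub x by (auto simp: add_submonoid_def)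
      fix a b assume ab: "a \<in> \<Lambda> - {x}" "b \<in> \<Lambda> - {x}"
      show "a + b \<in> \<Lambda> - {x}"
        using sub x ab by (cases "a = 0"; cases "b = 0") (auto simp: add_submonoid_def)
    qed
    then have "B \<subseteq> \<Lambda> - {x} \<Longrightarrow> \<Lambda> \<subseteq> \<Lambda> - {x}"
      using B hull_minimal[of B "\<Lambda> - {x}" add_submonoid] by (simp add: generates_def)
    then show "x \<in> B" using BL x by blast
  qed
  have "x \<in> \<Lambda> \<Longrightarrow> x \<in> add_submonoid hull ?P" for x
  proof (induction x rule: less_induct)
    case (less x)
    have H: "0 \<in> add_submonoid hull ?P"
      "\<And>u v. u \<in> add_submonoid hull ?P \<Longrightarrow> v \<in> add_submonoid hull ?P \<Longrightarrow> u + v \<in> add_submonoid hull ?P"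
      using add_submonoid_hull[of ?P] unfolding add_submonoid_def[of "add_submonoid hull ?P"] by blast+
    show ?case
    proof (cases "x = 0 \<or> x \<in> ?P")
      case True
      then show ?thesis using H(1) hull_subset[of ?P add_submonoid] by blast
    next
      case False
      then obtain a b where ab: "a \<in> \<Lambda> - {0}" "b \<in> \<Lambda> - {0}" "x = a + b"
        using less.prems by blast
      then have "a \<in> add_submonoid hull ?P" "b \<in> add_submonoid hull ?P"
        using less.IH[of a] less.IH[of b] by auto
      then show ?thesis using H(2) ab(3) by blast
    qed
  qed
  then have gen: "generates ?P \<Lambda>"
    unfolding generates_def using hull_minimal[of ?P \<Lambda> add_submonoid] sub by blast
  show ?thesis
    unfolding minimal_generators_def using gen least by (metis (no_types, lifting) psubsetI psubset_subset_trans psubset_eq)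
qed

lemma ex1_minimal_generators:
  assumes "numerical_semigroup \<Lambda>"
  shows "\<exists>!A. minimal_generators A \<Lambda>"
  by (simp add: minimal_generators_iff[OF assms])

lemma finite_minimal_generators:
  assumes S: "numerical_semigroup \<Lambda>" and A: "minimal_generators A \<Lambda>"
  shows "finite A"
proof -
  obtain c where c: "\<And>y. y \<notin> \<Lambda> \<Longrightarrow> y \<le> c"
    using S unfolding numerical_semigroup_def finite_nat_set_iff_bounded_le by blast
  have m: "Suc c \<in> \<Lambda>" using c[of "Suc c"] by auto
  have "x \<le> 2 * c + 2" if x: "x \<in> A" for x
  proof (rule ccontr)
    assume "\<not> x \<le> 2 * c + 2"
    then have "\<not> x - Suc c \<le> c" "x - Suc c \<noteq> 0" "x = (x - Suc c) + Suc c" by auto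
    moreover from this have "x - Suc c \<in> \<Lambda> - {0}" using c[of "x - Suc c"] by blast
    moreover have "Suc c \<in> \<Lambda> - {0}" using m by simp
    ultimately have "\<exists>a\<in>\<Lambda> - {0}. \<exists>b\<in>\<Lambda> - {0}. x = a + b" by blast
    then show False using A x unfolding minimal_generators_iff[OF S] by blast
  qed
  then show ?thesis unfolding finite_nat_set_iff_bounded_le by blast
qed

definition semigroup_ideal :: "nat set \<Rightarrow> nat set \<Rightarrow> bool" where
  "semigroup_ideal \<Lambda> I \<longleftrightarrow> I \<noteq> {} \<and> I \<subseteq> \<Lambda> \<and> (\<forall>i\<in>I. \<forall>s\<in>\<Lambda>. i + s \<in> I)"

definition proper_ideal :: "nat set \<Rightarrow> nat set \<Rightarrow> bool" where
  "proper_ideal \<Lambda> I \<longleftrightarrow> semigroup_ideal \<Lambda> I \<and> I \<noteq> \<Lambda>"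

text \<open>The family may be of any size at least two, with no finiteness assumption; only
  finitely many ideals contain a given one, so nothing depends on this.\<close>

definition irreducible_ideal :: "nat set \<Rightarrow> nat set \<Rightarrow> bool" where
  "irreducible_ideal \<Lambda> I \<longleftrightarrow> proper_ideal \<Lambda> I \<and>
    \<not> (\<exists>\<F>. (\<exists>J\<in>\<F>. \<exists>K\<in>\<F>. J \<noteq> K) \<and> (\<forall>J\<in>\<F>. proper_ideal \<Lambda> J \<and> I \<subset> J) \<and> I = \<Inter>\<F>)"

text \<open>A simple graph is a pair of a vertex set and a set of two-element sets of vertices.\<close>

type_synonym 'a sgraph = "'a set \<times> 'a set set"

abbreviation verts :: "'a sgraph \<Rightarrow> 'a set" where "verts G \<equiv> fst G"
abbreviation edges :: "'a sgraph \<Rightarrow> 'a set set" where "edges G \<equiv> snd G"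

abbreviation order_of :: "'a sgraph \<Rightarrow> nat" where "order_of G \<equiv> card (verts G)"

definition graph_iso :: "'a sgraph \<Rightarrow> 'b sgraph \<Rightarrow> bool" where
  "graph_iso G H \<longleftrightarrow> (\<exists>f. bij_betw f (verts G) (verts H) \<and>
    (\<forall>u\<in>verts G. \<forall>v\<in>verts G. {u, v} \<in> edges G \<longleftrightarrow> {f u, f v} \<in> edges H))"

text \<open>A plane drawing places the vertices at distinct points and draws each edge as a simple
  arc joining its two ends, passing through no other vertex; two distinct arcs meet at most
  in the images of common end vertices.\<close>

definition plane_drawing ::
  "'a sgraph \<Rightarrow> ('a \<Rightarrow> real \<times> real) \<Rightarrow> ('a set \<Rightarrow> real \<Rightarrow> real \<times> real) \<Rightarrow> bool" where
  "plane_drawing G p \<gamma> \<longleftrightarrow>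
    inj_on p (verts G) \<and>
    (\<forall>e\<in>edges G. arc (\<gamma> e) \<and> {pathstart (\<gamma> e), pathfinish (\<gamma> e)} = p ` e) \<and>
    (\<forall>e\<in>edges G. \<forall>v\<in>verts G. p v \<in> path_image (\<gamma> e) \<longrightarrow> v \<in> e) \<and>
    (\<forall>e\<in>edges G. \<forall>f\<in>edges G. e \<noteq> f \<longrightarrow>
      path_image (\<gamma> e) \<inter> path_image (\<gamma> f) \<subseteq> p ` (e \<inter> f))"

definition planar :: "'a sgraph \<Rightarrow> bool" where
  "planar G \<longleftrightarrow> (\<exists>p \<gamma>. plane_drawing G p \<gamma>)"

text \<open>The vertex \<open>v\<^sub>i\<close> is represented by its index \<open>i\<close>.\<close>

definition ideal_graph :: "nat set \<Rightarrow> nat set \<Rightarrow> nat sgraph" where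
  "ideal_graph \<Lambda> I = ((\<Lambda> - I) - {0},
    {{i, j} | i j. i \<in> (\<Lambda> - I) - {0} \<and> j \<in> (\<Lambda> - I) - {0} \<and> i \<noteq> j \<and> i + j \<in> I})"

definition H1 :: "nat sgraph" where
  "H1 = ({1..6}, {{1,2},{2,3},{2,4},{2,5},{2,6},{3,4},{3,6},{4,6},{5,6}})"

definition H2 :: "nat sgraph" where
  "H2 = ({1..6}, {{1,2},{1,5},{2,3},{2,4},{2,5},{2,6},{3,5},{3,6},{4,5},{4,6},{5,6}})"

definition H3 :: "nat sgraph" where
  "H3 = ({1..6}, {{1,2},{1,5},{2,3},{2,4},{2,5},{2,6},{3,4},{3,5},{3,6},{4,5},{4,6}})"

definition H4 :: "nat sgraph" where
  "H4 = ({1..6}, {{1,2},{1,3},{1,4},{1,5},{1,6},{2,3},{2,4},{2,5},{2,6},{3,6},{4,5},{4,6}})"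

definition K1 :: "nat sgraph" where
  "K1 = ({1..7}, {{1,2},{1,3},{1,4},{1,5},{1,6},{1,7},{2,4},{2,5},{2,6},{2,7},{4,7},{5,7}})"

definition K2 :: "nat sgraph" where
  "K2 = ({1..7}, {{3, j} | j. j \<in> {1..7} - {3}} \<union>
    {{1,2},{1,5},{1,6},{1,7},{2,6},{2,7},{4,6},{5,6}})"

definition K3 :: "nat sgraph" where
  "K3 = ({1..7}, {{3, j} | j. j \<in> {1..7} - {3}} \<union>
    {{1,2},{1,5},{1,6},{1,7},{2,4},{2,6},{2,7},{4,7},{5,7}})"

end

theory Submission
  imports Defs
begin

text \<open>
  Order 6 and 7 need only straight-line drawings of the seven listed graphs. For order 5 it is
  enough that the graph is not complete, since \<open>K\<^sub>5\<close> minus an edge is planar. Let \<open>m\<close> be the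
  largest element of \<open>\<Lambda> - I\<close>. If \<open>a \<noteq> m\<close> were such that \<open>a + s \<in> I\<close> for all nonzero
  \<open>s \<in> \<Lambda>\<close>, then \<open>I\<close> would be the intersection of the larger ideals \<open>insert a I\<close> and
  \<open>insert m I\<close>. So every \<open>a \<noteq> m\<close> has a nonzero \<open>s \<in> \<Lambda>\<close> with \<open>a + s \<notin> I\<close>;
  completeness forces \<open>s = a\<close>, i.e. \<open>2a \<notin> I\<close>. If \<open>2a \<noteq> m\<close> then likewise \<open>4a \<notin> I\<close>,
  whereas \<open>3a \<in> I\<close> by completeness. Hence \<open>2a = m\<close> for every \<open>a \<noteq> m\<close>, so there are at most
  two vertices.
\<close>

section \<open>Straight-line drawings\<close>

text \<open>Twice the signed area of the triangle \<open>a\<close>, \<open>b\<close>,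
  \<open>c\<close>. It is stated over any commutative ring so that one formula serves both integer
  computation and real drawings.\<close>

definition orient :: "'r::comm_ring_1 \<times> 'r \<Rightarrow> 'r \<times> 'r \<Rightarrow> 'r \<times> 'r \<Rightarrow> 'r" where
  "orient a b c = (fst b - fst a) * (snd c - snd a) - (snd b - snd a) * (fst c - fst a)"

definition same_side :: "'r::linordered_idom \<times> 'r \<Rightarrow> 'r \<times> 'r \<Rightarrow> 'r \<times> 'r \<Rightarrow> 'r \<times> 'r \<Rightarrow> bool" where
  "same_side a b c d \<longleftrightarrow> 0 < orient a b c * orient a b d"

lemma orient_convex:
  fixes a b c d :: "real \<times> real"
  shows "orient a b ((1 - u) *\<^sub>R c + u *\<^sub>R d) = (1 - u) * orient a b c + u * orient a b d"
  unfolding orient_def by (simp add: algebra_simps)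

lemma orient_self [simp]: "orient a b a = 0" "orient a b b = 0"
  unfolding orient_def by (simp_all add: algebra_simps)

lemma orient_on_segment:
  fixes a b z :: "real \<times> real"
  assumes "z \<in> closed_segment a b"
  shows "orient a b z = 0"
  using assms by (auto simp: in_segment orient_convex)

text \<open>At a point of the first segment \<open>orient a b\<close> vanishes. On the second
  segment it is a convex combination of two nonzero numbers of the same sign, hence never
  zero.\<close>

lemma same_side_imp_disjoint_segments:
  fixes a b c d :: "real \<times> real"
  assumes "same_side a b c d"
  shows "closed_segment a b \<inter> closed_segment c d = {}"
proof (rule ccontr)
  assume "closed_segment a b \<inter> closed_segment c d \<noteq> {}"
  then obtain z where z: "z \<in> closed_segment a b" "z \<in> closed_segment c d" by blast
  obtain u where u: "0 \<le> u" "u \<le> 1" "z = (1 - u) *\<^sub>R c + u *\<^sub>R d"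
    using z(2) by (auto simp: in_segment)
  have "(1 - u) * orient a b c + u * orient a b d = 0"
    using orient_on_segment[OF z(1)] u(3) by (simp add: orient_convex)
  moreover have "(0 < orient a b c \<and> 0 < orient a b d) \<or> (orient a b c < 0 \<and> orient a b d < 0)"
    using assms by (simp add: same_side_def zero_less_mult_iff)
  \<comment> \<open>\<open>convex_bound_lt\<close> only bounds from above, so it excludes the
    negative case directly and the positive case after negation.\<close>
  ultimately show False
    using u(1,2) convex_bound_lt[of "orient a b c" 0 "orient a b d" "1 - u" u]
      convex_bound_lt[of "- orient a b c" 0 "- orient a b d" "1 - u" u]
    by auto
qed

text \<open>Moving from \<open>a\<close> towards \<open>c\<close>, the orientation relative to
  \<open>a\<close>, \<open>b\<close> grows linearly from 0, so the segment meets the line through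
  \<open>a\<close> and \<open>b\<close> only at \<open>a\<close>.\<close>

lemma segments_share_endpoint:
  fixes a b c :: "real \<times> real"
  assumes "orient a b c \<noteq> 0"
  shows "closed_segment a b \<inter> closed_segment a c \<subseteq> {a}"
proof
  fix z assume z: "z \<in> closed_segment a b \<inter> closed_segment a c"
  then obtain u where u: "z = (1 - u) *\<^sub>R a + u *\<^sub>R c" by (auto simp: in_segment)
  have "orient a b z = 0" using z orient_on_segment by blast
  then have "u = 0" using assms by (simp add: u orient_convex)
  then show "z \<in> {a}" by (simp add: u)
qed

text \<open>\<open>off\<close> keeps vertices off the whole line of an edge, not just off the
  segment. It thus handles both vertices on edges and edges with a common end. In such a position,
  two edges without a common end cross exactly when each separates the ends of the other, so
  \<open>sep\<close> says that they do not cross.\<close>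

lemma straight_line_planar:
  fixes p :: "'a \<Rightarrow> real \<times> real"
  assumes inj: "inj_on p (verts G)"
    and edge: "\<And>e. e \<in> edges G \<Longrightarrow> \<exists>a\<in>verts G. \<exists>b\<in>verts G. a \<noteq> b \<and> e = {a, b}"
    and off: "\<And>a b c. {a, b} \<in> edges G \<Longrightarrow> c \<in> verts G - {a, b} \<Longrightarrow> orient (p a) (p b) (p c) \<noteq> 0"
    and sep: "\<And>a b c d. {a, b} \<in> edges G \<Longrightarrow> {c, d} \<in> edges G \<Longrightarrow> {a, b} \<inter> {c, d} = {} \<Longrightarrow>
      same_side (p a) (p b) (p c) (p d) \<or> same_side (p c) (p d) (p a) (p b)"
  shows "planar G"
proof -
  \<comment> \<open>The image is given as a convex hull because this depends on the edge as a set,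
    whereas a line path needs a choice of direction.\<close>
  have "\<exists>g. arc g \<and> {pathstart g, pathfinish g} = p ` e \<and> path_image g = convex hull (p ` e)"
    if e: "e \<in> edges G" for e
  proof -
    obtain a b where ab: "a \<in> verts G" "b \<in> verts G" "a \<noteq> b" "e = {a, b}"
      using edge[OF e] by blast
    then have "p a \<noteq> p b" using inj by (auto dest: inj_onD)
    then show ?thesis
      by (intro exI[of _ "linepath (p a) (p b)"]) (simp add: ab segment_convex_hull)
  qed
  then obtain \<gamma> where \<gamma>: "\<And>e. e \<in> edges G \<Longrightarrow>
      arc (\<gamma> e) \<and> {pathstart (\<gamma> e), pathfinish (\<gamma> e)} = p ` e \<and> path_image (\<gamma> e) = convex hull (p ` e)"
    by metis
  have seg: "path_image (\<gamma> {a, b}) = closed_segment (p a) (p b)" if "{a, b} \<in> edges G" for a b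
    using \<gamma>[OF that] by (simp add: segment_convex_hull)
  have "v \<in> e" if e: "e \<in> edges G" and v: "v \<in> verts G" "p v \<in> path_image (\<gamma> e)" for e v
  proof (rule ccontr)
    assume "v \<notin> e"
    moreover obtain a b where "e = {a, b}" using edge[OF e] by blast
    ultimately show False
      using e v off[of a b v] seg[of a b] orient_on_segment by blast
  qed
  moreover have "path_image (\<gamma> e) \<inter> path_image (\<gamma> f) \<subseteq> p ` (e \<inter> f)"
    if e: "e \<in> edges G" and f: "f \<in> edges G" and ne: "e \<noteq> f" for e f
  proof (cases "e \<inter> f = {}")
    case True
    obtain a b c d where "e = {a, b}" "f = {c, d}" using edge[OF e] edge[OF f] by blast
    then show ?thesis
      using True e f sep[of a b c d] seg[of a b] seg[of c d] same_side_imp_disjoint_segments by blast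
  next
    case False
    then obtain a where a: "a \<in> e" "a \<in> f" by blast
    obtain b where b: "e = {a, b}" "b \<in> verts G" using edge[OF e] a by blast
    obtain c where c: "f = {a, c}" "c \<in> verts G" "c \<noteq> a" using edge[OF f] a by blast
    have "c \<noteq> b" using b c ne by blast
    then have "orient (p a) (p b) (p c) \<noteq> 0" using off[of a b c] b c e by blast
    then show ?thesis
      using segments_share_endpoint seg[of a b] seg[of a c] e f a b(1) c(1) by blast
  qed
  ultimately have "plane_drawing G p \<gamma>"
    unfolding plane_drawing_def using inj \<gamma> by blast
  then show ?thesis unfolding planar_def by blast
qed

section \<open>Checking a drawing on the integer grid\<close>

text \<open>The hypotheses of \<open>straight_line_planar\<close>, with all quantifiers over finite
  lists and all coordinates integers, so that evaluation decides them. Vertices are numbered from 1,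
  hence the index shift in \<open>ps\<close>.\<close>

definition grid_drawing :: "(int \<times> int) list \<Rightarrow> (nat \<times> nat) list \<Rightarrow> bool" where
  "grid_drawing ps es \<longleftrightarrow> distinct ps \<and>
    list_all (\<lambda>(a, b). a \<noteq> b \<and> a \<in> set [1..<Suc (length ps)] \<and> b \<in> set [1..<Suc (length ps)] \<and>
      list_all (\<lambda>c. c = a \<or> c = b \<or> orient (ps ! (a - 1)) (ps ! (b - 1)) (ps ! (c - 1)) \<noteq> 0)
        [1..<Suc (length ps)] \<and>
      list_all (\<lambda>(c, d). a = c \<or> a = d \<or> b = c \<or> b = d \<or>
        same_side (ps ! (a - 1)) (ps ! (b - 1)) (ps ! (c - 1)) (ps ! (d - 1)) \<or>
        same_side (ps ! (c - 1)) (ps ! (d - 1)) (ps ! (a - 1)) (ps ! (b - 1))) es) es"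

definition list_graph :: "nat \<Rightarrow> (nat \<times> nat) list \<Rightarrow> nat sgraph" where
  "list_graph n es = ({1..n}, (\<lambda>(a, b). {a, b}) ` set es)"

lemma orient_of_int:
  "orient (map_prod of_int of_int a) (map_prod of_int of_int b) (map_prod of_int of_int c)
    = (of_int (orient a b c) :: real)"
  by (simp add: orient_def)

lemma orient_swap: "orient b a c = - orient a b c"
  by (simp add: orient_def algebra_simps)

lemma same_side_of_int:
  "same_side (map_prod of_int of_int a) (map_prod of_int of_int b)
     (map_prod of_int of_int c) (map_prod of_int of_int d :: real \<times> real) \<longleftrightarrow> same_side a b c d"
  unfolding same_side_def orient_of_int by (metis of_int_0_less_iff of_int_mult)

lemma same_side_swap: "same_side b a c d = same_side a b c d" "same_side a b d c = same_side a b c d"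
  by (simp_all add: same_side_def orient_swap[of b a] mult.commute)

lemma grid_drawing_planar:
  assumes "grid_drawing ps es"
  shows "planar (list_graph (length ps) es)" (is "planar ?G")
proof -
  define q where "q = (\<lambda>i. ps ! (i - 1))"
  define p :: "nat \<Rightarrow> real \<times> real" where "p = map_prod of_int of_int \<circ> q"
  have inj: "inj_on q {1..length ps}"
    using assms by (auto simp: grid_drawing_def q_def inj_on_def nth_eq_iff_index_eq)
  have E: "a \<noteq> b \<and> a \<in> {1..length ps} \<and> b \<in> {1..length ps} \<and>
      (\<forall>c\<in>{1..length ps}. c = a \<or> c = b \<or> orient (q a) (q b) (q c) \<noteq> 0) \<and>
      (\<forall>(c, d)\<in>set es. a = c \<or> a = d \<or> b = c \<or> b = d \<or>
        same_side (q a) (q b) (q c) (q d) \<or> same_side (q c) (q d) (q a) (q b))"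
    if "(a, b) \<in> set es" for a b
    using assms[unfolded grid_drawing_def list_all_iff, THEN conjunct2, rule_format, OF that]
    unfolding q_def prod.case set_upt atLeastLessThanSuc_atLeastAtMost by blast
  have ends: "a \<in> {1..length ps} \<and> b \<in> {1..length ps} \<and> a \<noteq> b" if "(a, b) \<in> set es" for a b
    using E[OF that] by blast
  have off: "orient (q a) (q b) (q c) \<noteq> 0"
    if "(a, b) \<in> set es" "c \<in> {1..length ps}" "c \<noteq> a" "c \<noteq> b" for a b c
    using E[OF that(1)] that(2-4) by blast
  have sep: "same_side (q a) (q b) (q c) (q d) \<or> same_side (q c) (q d) (q a) (q b)"
    if "(a, b) \<in> set es" "(c, d) \<in> set es" "a \<noteq> c" "a \<noteq> d" "b \<noteq> c" "b \<noteq> d" for a b c d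
    using bspec[of "set es" _ "(c, d)", OF _ that(2)] E[OF that(1)] that(3-6) by fast
  \<comment> \<open>An edge is listed in some direction that need not match \<open>{a, b}\<close> as
    written. The swap lemmas transfer the checked conditions to the other direction.\<close>
  have dir: "(a, b) \<in> set es \<or> (b, a) \<in> set es" if "{a, b} \<in> edges ?G" for a b
    using that by (auto simp: list_graph_def doubleton_eq_iff)
  show ?thesis
  proof (rule straight_line_planar[of p])
    show "inj_on p (verts ?G)"
      using inj unfolding p_def list_graph_def fst_conv
      by (intro comp_inj_on) (auto simp: inj_on_def map_prod_def split: prod.splits)
  next
    fix e assume "e \<in> edges ?G"
    then obtain a b where ab: "(a, b) \<in> set es" "e = {a, b}" by (auto simp: list_graph_def)
    then show "\<exists>a\<in>verts ?G. \<exists>b\<in>verts ?G. a \<noteq> b \<and> e = {a, b}"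
      unfolding list_graph_def fst_conv using ends[OF ab(1)] by blast
  next
    fix a b c assume e: "{a, b} \<in> edges ?G" and c: "c \<in> verts ?G - {a, b}"
    then have "c \<in> {1..length ps}" "c \<noteq> a" "c \<noteq> b" by (auto simp: list_graph_def)
    then have "orient (q a) (q b) (q c) \<noteq> 0"
      using dir[OF e] off[of a b c] off[of b a c] orient_swap[of "q a" "q b" "q c"] by auto
    then show "orient (p a) (p b) (p c) \<noteq> 0"
      by (simp add: p_def orient_of_int)
  next
    fix a b c d assume *: "{a, b} \<in> edges ?G" "{c, d} \<in> edges ?G" "{a, b} \<inter> {c, d} = {}"
    have "same_side (q a) (q b) (q c) (q d) \<or> same_side (q c) (q d) (q a) (q b)"
      using dir[OF *(1)] dir[OF *(2)]
    proof (elim disjE)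
      assume "(a, b) \<in> set es" "(c, d) \<in> set es"
      then show ?thesis using sep[of a b c d] *(3) by auto
    next
      assume "(a, b) \<in> set es" "(d, c) \<in> set es"
      then show ?thesis using sep[of a b d c] *(3) by (auto simp: same_side_swap)
    next
      assume "(b, a) \<in> set es" "(c, d) \<in> set es"
      then show ?thesis using sep[of b a c d] *(3) by (auto simp: same_side_swap)
    next
      assume "(b, a) \<in> set es" "(d, c) \<in> set es"
      then show ?thesis using sep[of b a d c] *(3) by (auto simp: same_side_swap)
    qed
    then show "same_side (p a) (p b) (p c) (p d) \<or> same_side (p c) (p d) (p a) (p b)"
      by (simp add: p_def same_side_of_int)
  qed
qed

section \<open>Pulling drawings back along embeddings of graphs\<close>

text \<open>Draw \<open>v\<close> at the point of \<open>f v\<close> and \<open>e\<close> along the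
  arc of its image. Injectivity of \<open>f\<close> keeps distinct edges distinct and creates no new
  common ends. Nonadjacent vertices may have adjacent images, so this covers arbitrary subgraphs as
  well as isomorphisms.\<close>

lemma planar_embed:
  assumes H: "planar H"
    and inj: "inj_on f (verts G)" and img: "f ` verts G \<subseteq> verts H"
    and edge: "\<And>e. e \<in> edges G \<Longrightarrow> e \<subseteq> verts G \<and> f ` e \<in> edges H"
  shows "planar G"
proof -
  obtain p \<gamma> where D: "plane_drawing H p \<gamma>" using H unfolding planar_def by blast
  have "path_image (\<gamma> (f ` e)) \<inter> path_image (\<gamma> (f ` e')) \<subseteq> (p \<circ> f) ` (e \<inter> e')"
    if e: "e \<in> edges G" "e' \<in> edges G" "e \<noteq> e'" for e e'
  proof -
    have "f ` e \<noteq> f ` e'" "f ` e \<inter> f ` e' = f ` (e \<inter> e')"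
      using e edge inj by (simp_all add: inj_on_image_eq_iff inj_on_image_Int)
    then show ?thesis
      using D e edge unfolding plane_drawing_def by (metis image_comp)
  qed
  moreover have "v \<in> e" if "e \<in> edges G" "v \<in> verts G" "(p \<circ> f) v \<in> path_image (\<gamma> (f ` e))" for e v
  proof -
    have "f v \<in> f ` e" using D edge img that unfolding plane_drawing_def by auto
    then show ?thesis using inj edge that by (meson inj_on_image_mem_iff)
  qed
  moreover have "inj_on (p \<circ> f) (verts G)"
    using D inj img unfolding plane_drawing_def by (meson comp_inj_on inj_on_subset)
  ultimately have "plane_drawing G (p \<circ> f) (\<lambda>e. \<gamma> (f ` e))"
    using D edge unfolding plane_drawing_def by (simp add: image_comp)
  then show ?thesis unfolding planar_def by blast
qed

lemma planar_graph_iso: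
  assumes "planar H" "graph_iso G H"
    and edge: "\<And>e. e \<in> edges G \<Longrightarrow> \<exists>a\<in>verts G. \<exists>b\<in>verts G. a \<noteq> b \<and> e = {a, b}"
  shows "planar G"
proof -
  obtain f where f: "bij_betw f (verts G) (verts H)"
    "\<forall>u\<in>verts G. \<forall>v\<in>verts G. {u, v} \<in> edges G \<longleftrightarrow> {f u, f v} \<in> edges H"
    using assms(2) unfolding graph_iso_def by blast
  show ?thesis
  proof (rule planar_embed[OF assms(1)])
    show "inj_on f (verts G)" "f ` verts G \<subseteq> verts H" using f(1) by (auto simp: bij_betw_def)
    fix e assume e: "e \<in> edges G"
    then obtain a b where "a \<in> verts G" "b \<in> verts G" "e = {a, b}" using edge by blast
    then show "e \<subseteq> verts G \<and> f ` e \<in> edges H" using f(2) e by auto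
  qed
qed

text \<open>The identity embeds \<open>G\<close> into the drawn graph; inclusions suffice because
  subgraphs of planar graphs are planar.\<close>

lemma planar_if_grid_drawing:
  assumes "grid_drawing ps es" "verts G \<subseteq> {1..length ps}" "\<Union> (edges G) \<subseteq> verts G"
    and "edges G \<subseteq> (\<lambda>(a, b). {a, b}) ` set es"
  shows "planar G"
  using assms by (intro planar_embed[OF grid_drawing_planar, of ps es "\<lambda>x. x"]) (auto simp: list_graph_def)

section \<open>Drawings of the listed graphs of order 6 and 7\<close>

lemma star_edges:
  "{{3, j} | j. j \<in> {1..7} - {3}} = {{3, 1}, {3, 2}, {3, 4}, {3, 5}, {3, 6}, {3, 7::nat}}"
proof -
  have "{1..7} - {3} = {1, 2, 4, 5, 6, 7::nat}" by auto
  then show ?thesis by (simp only: Setcompr_eq_image image_insert image_empty)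
qed

lemma planar_H1: "planar H1"
proof (rule planar_if_grid_drawing)
  \<comment> \<open>The points are the positions of vertices 1 to 6. Any crossing-free straight-line
    drawing with integer coordinates would serve, provided no vertex lies on the line of an edge not
    containing it. The other graphs are treated in the same way.\<close>
  show "grid_drawing [(0,3), (1,1), (2,0), (2,1), (1,2), (3,3)]
      [(1,2), (2,3), (2,4), (2,5), (2,6), (3,4), (3,6), (4,6), (5,6)]"
    by code_simp
qed (auto simp: H1_def)

lemma planar_H2: "planar H2"
proof (rule planar_if_grid_drawing)
  show "grid_drawing [(0,2), (3,3), (3,0), (2,2), (0,1), (2,1)]
      [(1,2), (1,5), (2,3), (2,4), (2,5), (2,6), (3,5), (3,6), (4,5), (4,6), (5,6)]"
    by code_simp
qed (auto simp: H2_def)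

lemma planar_H3: "planar H3"
proof (rule planar_if_grid_drawing)
  show "grid_drawing [(2,3), (0,3), (1,0), (2,2), (3,2), (1,1)]
      [(1,2), (1,5), (2,3), (2,4), (2,5), (2,6), (3,4), (3,5), (3,6), (4,5), (4,6)]"
    by code_simp
qed (auto simp: H3_def)

lemma planar_H4: "planar H4"
proof (rule planar_if_grid_drawing)
  show "grid_drawing [(3,4), (1,2), (1,3), (2,0), (2,2), (0,3)]
      [(1,2), (1,3), (1,4), (1,5), (1,6), (2,3), (2,4), (2,5), (2,6), (3,6), (4,5), (4,6)]"
    by code_simp
qed (auto simp: H4_def)

lemma planar_K1: "planar K1"
proof (rule planar_if_grid_drawing)
  show "grid_drawing [(0,3), (1,0), (2,3), (3,2), (1,1), (0,1), (2,2)]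
      [(1,2), (1,3), (1,4), (1,5), (1,6), (1,7), (2,4), (2,5), (2,6), (2,7), (4,7), (5,7)]"
    by code_simp
qed (auto simp: K1_def)

lemma planar_K2: "planar K2"
proof (rule planar_if_grid_drawing)
  show "grid_drawing [(2,3), (0,4), (1,0), (4,0), (3,3), (4,4), (1,2)]
      [(3,1), (3,2), (3,4), (3,5), (3,6), (3,7), (1,2), (1,5), (1,6), (1,7), (2,6), (2,7), (4,6), (5,6)]"
    by code_simp
qed (auto simp: K2_def[unfolded star_edges])

lemma planar_K3: "planar K3"
proof (rule planar_if_grid_drawing)
  show "grid_drawing [(1,0), (5,3), (2,2), (3,3), (1,2), (2,1), (0,4)]
      [(3,1), (3,2), (3,4), (3,5), (3,6), (3,7), (1,2), (1,5), (1,6), (1,7), (2,4), (2,6), (2,7), (4,7),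
      (5,7)]"
    by code_simp
qed (auto simp: K3_def[unfolded star_edges])

section \<open>Graphs of order at most 5\<close>

definition K5_minus_edge :: "nat sgraph" where
  "K5_minus_edge = ({1..5}, {{a, b} | a b. a \<in> {1..5} \<and> b \<in> {1..5} \<and> a \<noteq> b} - {{4, 5}})"

lemma planar_K5_minus_edge: "planar K5_minus_edge"
proof (rule planar_if_grid_drawing)
  \<comment> \<open>Vertices 1, 2, 3 form a triangle with 5 inside and 4 outside, so the omitted
    edge is the one that would have to cross it.\<close>
  show "grid_drawing [(1,2), (3,1), (0,0), (0,3), (1,1)]
      [(1,2), (1,3), (1,4), (1,5), (2,3), (2,4), (2,5), (3,4), (3,5)]"
    by code_simp
  show "edges K5_minus_edge \<subseteq> (\<lambda>(a, b). {a, b}) ` set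
      [(1,2), (1,3), (1,4), (1,5), (2,3), (2,4), (2,5), (3,4), (3,5)]"
  proof
    fix e assume e: "e \<in> edges K5_minus_edge"
    then obtain a b where "a \<noteq> b" "a \<in> {1..5}" "b \<in> {1..5}" "e = {a, b}"
      by (auto simp: K5_minus_edge_def)
    \<comment> \<open>The list contains each edge with its smaller end first, so the ends are sorted
      before the finite case check.\<close>
    then obtain c d where cd: "1 \<le> c" "c < d" "d \<le> 5" "e = {c, d}"
      by (intro that[of "min a b" "max a b"]) (auto simp: min_def max_def)
    moreover have "\<not> (c = 4 \<and> d = 5)" using e cd(4) by (auto simp: K5_minus_edge_def)
    moreover have "c = 1 \<or> c = 2 \<or> c = 3 \<or> c = 4" "d = 2 \<or> d = 3 \<or> d = 4 \<or> d = 5"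
      using cd by arith+
    ultimately have "(c, d) \<in> set
      [(1,2), (1,3), (1,4), (1,5), (2,3), (2,4), (2,5), (3,4), (3,5)]"
      by auto
    then show "e \<in> (\<lambda>(a, b). {a, b}) ` set
      [(1,2), (1,3), (1,4), (1,5), (2,3), (2,4), (2,5), (3,4), (3,5)]"
      using cd(4) by (intro image_eqI[of _ _ "(c, d)"]) simp_all
  qed
qed (auto simp: K5_minus_edge_def)

text \<open>At order 5, a nonadjacent pair is sent to the ends 4, 5 of the edge missing from
  \<open>K5_minus_edge\<close>. A smaller graph fits into \<open>{1..4}\<close> and so avoids that
  edge automatically.\<close>

lemma planar_order_le_5:
  assumes fin: "finite (verts G)" and le: "order_of G \<le> 5"
    and edge: "\<And>e. e \<in> edges G \<Longrightarrow> \<exists>a\<in>verts G. \<exists>b\<in>verts G. a \<noteq> b \<and> e = {a, b}"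
    and non: "order_of G = 5 \<Longrightarrow> \<exists>u\<in>verts G. \<exists>v\<in>verts G. u \<noteq> v \<and> {u, v} \<notin> edges G"
  shows "planar G"
proof -
  have "\<exists>f :: 'a \<Rightarrow> nat. inj_on f (verts G) \<and> f ` verts G \<subseteq> {1..5} \<and>
      (\<forall>e\<in>edges G. f ` e \<noteq> {4, 5})"
  proof (cases "order_of G = 5")
    case True
    then obtain u v where uv: "u \<in> verts G" "v \<in> verts G" "u \<noteq> v" "{u, v} \<notin> edges G"
      using non by blast
    have "card (verts G - {u, v}) = 3" using True uv by (simp add: card_Diff_subset)
    then obtain g :: "'a \<Rightarrow> nat" where g: "bij_betw g (verts G - {u, v}) {1..3}"
      using finite_same_card_bij[of "verts G - {u, v}" "{1..3::nat}"] fin by auto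
    define f where "f = g(u := 4, v := 5)"
    have fg: "f w = g w \<and> f w \<le> 3 \<and> 1 \<le> f w" if "w \<in> verts G - {u, v}" for w
      using bij_betwE[OF g] that by (auto simp: f_def)
    have fuv: "f u = 4" "f v = 5" using uv by (auto simp: f_def)
    have "inj_on f (verts G)"
    proof (rule inj_onI)
      fix x y assume xy: "x \<in> verts G" "y \<in> verts G" "f x = f y"
      show "x = y"
      proof (cases "x \<in> {u, v} \<or> y \<in> {u, v}")
        case True
        then show ?thesis using xy fg[of x] fg[of y] fuv by (cases "x \<in> {u, v}"; cases "y \<in> {u, v}") auto
      next
        case False
        then show ?thesis using xy fg[of x] fg[of y] g by (auto simp: bij_betw_def dest: inj_onD)
      qed
    qed
    moreover have "f w \<in> {1..5}" if "w \<in> verts G" for w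
      using fg[of w] fuv that by (cases "w \<in> {u, v}") auto
    moreover have "f ` e \<noteq> {4, 5}" if e: "e \<in> edges G" for e
    proof
      assume "f ` e = {4, 5}"
      then have "f ` e = f ` {u, v}" using fuv by simp
      moreover have "e \<subseteq> verts G" using edge[OF e] by blast
      ultimately have "e = {u, v}"
        using \<open>inj_on f (verts G)\<close> uv by (meson empty_subsetI inj_on_image_eq_iff insert_subset)
      then show False using e uv by blast
    qed
    ultimately show ?thesis by blast
  next
    case False
    then have "card (verts G) \<le> card {1..4::nat}" using le by simp
    then obtain f :: "'a \<Rightarrow> nat" where f: "f ` verts G \<subseteq> {1..4}" "inj_on f (verts G)"
      using card_le_inj[OF fin, of "{1..4::nat}"] by auto
    have "f ` e \<noteq> {4, 5}" if e: "e \<in> edges G" for e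
    proof -
      have "f ` e \<subseteq> {1..4}" using edge[OF e] f(1) by blast
      then show ?thesis by auto
    qed
    moreover have "f ` verts G \<subseteq> {1..5}" using f(1) by fastforce
    ultimately show ?thesis using f(2) by blast
  qed
  then obtain f :: "'a \<Rightarrow> nat" where f: "inj_on f (verts G)" "f ` verts G \<subseteq> {1..5}"
      "\<forall>e\<in>edges G. f ` e \<noteq> {4, 5}" by (elim exE conjE) (rule that)
  show ?thesis
  proof (rule planar_embed[OF planar_K5_minus_edge f(1)])
    show "f ` verts G \<subseteq> verts K5_minus_edge" using f(2) by (simp add: K5_minus_edge_def)
    fix e assume e: "e \<in> edges G"
    then obtain a b where ab: "a \<in> verts G" "b \<in> verts G" "a \<noteq> b" "e = {a, b}"
      using edge by blast
    have "f a \<in> {1..5}" "f b \<in> {1..5}" "f a \<noteq> f b" using ab f(1,2) by (auto dest: inj_onD)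
    then have "f ` e \<in> edges K5_minus_edge"
      using bspec[OF f(3) e] ab(4) unfolding K5_minus_edge_def snd_conv image_insert image_empty
      by blast
    then show "e \<subseteq> verts G \<and> f ` e \<in> edges K5_minus_edge" using ab by blast
  qed
qed

section \<open>Irreducible ideals\<close>

text \<open>For a fixed \<open>i\<close> in \<open>I\<close>, the translate of \<Lambda> by
  \<open>i\<close> lies in \<open>I\<close>. So an \<open>x\<close> outside \<open>I\<close> is
  either below \<open>i\<close> or equal to \<open>i\<close> plus a gap of \<Lambda>, and there are
  finitely many gaps.\<close>

lemma finite_verts_ideal_graph:
  assumes S: "numerical_semigroup \<Lambda>" and I: "semigroup_ideal \<Lambda> I"
  shows "finite (verts (ideal_graph \<Lambda> I))"
proof -
  obtain i where i: "i \<in> I" using I by (auto simp: semigroup_ideal_def)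
  have "- I \<subseteq> {..<i} \<union> (+) i ` (- \<Lambda>)"
  proof
    fix x assume x: "x \<in> - I"
    have "x - i \<notin> \<Lambda>" if "i \<le> x"
      using that x i I by (metis ComplD le_add_diff_inverse semigroup_ideal_def)
    then show "x \<in> {..<i} \<union> (+) i ` (- \<Lambda>)"
      by (cases "x < i") (auto intro: image_eqI[of _ _ "x - i"])
  qed
  then have "finite (- I)"
    by (rule finite_subset) (use S in \<open>simp add: numerical_semigroup_def\<close>)
  then show ?thesis by (rule finite_subset[rotated]) (auto simp: ideal_graph_def)
qed

lemma edges_ideal_graph:
  assumes "e \<in> edges (ideal_graph \<Lambda> I)"
  shows "\<exists>a\<in>verts (ideal_graph \<Lambda> I). \<exists>b\<in>verts (ideal_graph \<Lambda> I). a \<noteq> b \<and> e = {a, b}"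
  using assms by (auto simp: ideal_graph_def)

text \<open>Every nonzero shift of \<open>a\<close> already lands in \<open>I\<close>, so adding
  \<open>a\<close> alone preserves closure; \<open>b\<close> stays outside and witnesses
  properness.\<close>

lemma insert_proper_ideal:
  assumes I: "semigroup_ideal \<Lambda> I"
    and a: "a \<in> \<Lambda>" "\<And>s. s \<in> \<Lambda> - {0} \<Longrightarrow> a + s \<in> I" and b: "b \<in> \<Lambda> - I" "b \<noteq> a"
  shows "proper_ideal \<Lambda> (insert a I)"
proof -
  have "x + s \<in> insert a I" if "x \<in> insert a I" "s \<in> \<Lambda>" for x s
    using that I a(2)[of s] by (cases "s = 0") (auto simp: semigroup_ideal_def)
  then show ?thesis
    using I a(1) b by (auto simp: proper_ideal_def semigroup_ideal_def)
qed

lemma irreducible_ideal_not_inter: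
  assumes I: "irreducible_ideal \<Lambda> I" and J: "proper_ideal \<Lambda> J" "I \<subset> J"
    and K: "proper_ideal \<Lambda> K" "I \<subset> K" and "J \<noteq> K"
  shows "I \<noteq> J \<inter> K"
proof
  assume "I = J \<inter> K"
  then have "(\<exists>A\<in>{J, K}. \<exists>B\<in>{J, K}. A \<noteq> B) \<and> (\<forall>A\<in>{J, K}. proper_ideal \<Lambda> A \<and> I \<subset> A) \<and> I = \<Inter>{J, K}"
    using J K \<open>J \<noteq> K\<close> by simp blast
  then have "\<exists>\<F>. (\<exists>A\<in>\<F>. \<exists>B\<in>\<F>. A \<noteq> B) \<and> (\<forall>A\<in>\<F>. proper_ideal \<Lambda> A \<and> I \<subset> A) \<and> I = \<Inter>\<F>"
    by (rule exI)
  then show False using I[unfolded irreducible_ideal_def, THEN conjunct2] by (rule notE[rotated])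
qed

text \<open>Maximality refers to the order in which \<open>x\<close> precedes \<open>x + s\<close>
  for \<open>s\<close> in \<Lambda>. The numerical maximum \<open>m\<close> is maximal there as
  well, and a second maximal element would split \<open>I\<close>. This consequence of
  irreducibility takes the place of the form \<Lambda> - B(x).\<close>

lemma irreducible_ideal_not_maximal:
  assumes S: "numerical_semigroup \<Lambda>" and I: "irreducible_ideal \<Lambda> I"
    and m: "m \<in> \<Lambda> - I" "\<And>x. x \<in> \<Lambda> - I \<Longrightarrow> x \<le> m" and a: "a \<in> \<Lambda> - I" "a \<noteq> m"
  obtains s where "s \<in> \<Lambda> - {0}" "a + s \<notin> I"
proof -
  have sub: "add_submonoid \<Lambda>" using S by (simp add: numerical_semigroup_def)
  have id: "semigroup_ideal \<Lambda> I" using I by (simp add: irreducible_ideal_def proper_ideal_def)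
  have ms: "m + s \<in> I" if "s \<in> \<Lambda> - {0}" for s
  proof (rule ccontr)
    assume "m + s \<notin> I"
    moreover have "m + s \<in> \<Lambda>" using m(1) that sub by (simp add: add_submonoid_def)
    ultimately have "m + s \<le> m" using m(2) by blast
    then show False using that by simp
  qed
  have "\<exists>s\<in>\<Lambda> - {0}. a + s \<notin> I"
  proof (rule ccontr)
    assume "\<not> ?thesis"
    then have as: "a + s \<in> I" if "s \<in> \<Lambda> - {0}" for s using that by blast
    have "proper_ideal \<Lambda> (insert a I)"
      by (rule insert_proper_ideal[OF id _ as m(1)]) (use a in auto)
    moreover have "proper_ideal \<Lambda> (insert m I)"
      by (rule insert_proper_ideal[OF id _ ms a]) (use m(1) in auto)
    moreover have "I \<subset> insert a I" "I \<subset> insert m I" "insert a I \<noteq> insert m I"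
      "I = insert a I \<inter> insert m I"
      using m(1) a by auto
    ultimately show False using irreducible_ideal_not_inter[OF I] by metis
  qed
  then show ?thesis using that by blast
qed

lemma complete_irreducible_ideal_graph_order_le_2:
  assumes S: "numerical_semigroup \<Lambda>" and I: "irreducible_ideal \<Lambda> I"
    and complete: "\<And>u v. u \<in> verts (ideal_graph \<Lambda> I) \<Longrightarrow> v \<in> verts (ideal_graph \<Lambda> I) \<Longrightarrow> u \<noteq> v \<Longrightarrow>
      {u, v} \<in> edges (ideal_graph \<Lambda> I)"
  shows "order_of (ideal_graph \<Lambda> I) \<le> 2"
proof (cases "verts (ideal_graph \<Lambda> I) = {}")
  case False
  let ?V = "\<Lambda> - I - {0}"
  have V: "verts (ideal_graph \<Lambda> I) = ?V" by (simp add: ideal_graph_def)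
  have id: "semigroup_ideal \<Lambda> I" using I by (simp add: irreducible_ideal_def proper_ideal_def)
  have sub: "x + y \<in> \<Lambda>" if "x \<in> \<Lambda>" "y \<in> \<Lambda>" for x y
    using S that by (simp add: numerical_semigroup_def add_submonoid_def)
  have add_I: "i + s \<in> I" if "i \<in> I" "s \<in> \<Lambda>" for i s
    using id that by (simp add: semigroup_ideal_def)
  have fin: "finite ?V" using finite_verts_ideal_graph[OF S id] V by simp
  define m where "m = Max ?V"
  \<comment> \<open>The bound includes 0, which may lie in \<open>\<Lambda> - I\<close> but never in
    \<open>?V\<close>; \<open>irreducible_ideal_not_maximal\<close> requires it in this
    form.\<close>
  have m: "m \<in> ?V" "\<And>x. x \<in> \<Lambda> - I \<Longrightarrow> x \<le> m"
  proof -
    show "m \<in> ?V" using False fin V unfolding m_def by (metis Max_in)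
    show "x \<le> m" if "x \<in> \<Lambda> - I" for x
      using fin that unfolding m_def by (cases "x = 0") auto
  qed
  have sum: "u + v \<in> I" if "u \<in> ?V" "v \<in> ?V" "u \<noteq> v" for u v
  proof -
    have "{u, v} \<in> edges (ideal_graph \<Lambda> I)" using complete that V by simp
    then show ?thesis by (auto simp: ideal_graph_def doubleton_eq_iff add.commute)
  qed
  have dbl: "2 * a \<in> ?V" if a: "a \<in> ?V" "a \<noteq> m" for a
  proof -
    obtain s where s: "s \<in> \<Lambda> - {0}" "a + s \<notin> I"
      using irreducible_ideal_not_maximal[OF S I _ m(2), of a] m(1) a by blast
    \<comment> \<open>Were \<open>s\<close> in \<open>I\<close>, so would be \<open>a + s\<close>.
      Hence \<open>s\<close> is a vertex, and a vertex other than \<open>a\<close> would be adjacent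
      to \<open>a\<close>.\<close>
    have "s \<notin> I" using add_I[of s a] s a by (auto simp: add.commute)
    then have "s = a" using sum[of a s] s a by auto
    then show ?thesis using s a sub[of a a] by (auto simp: mult_2)
  qed
  have "2 * a = m" if a: "a \<in> ?V" "a \<noteq> m" for a
  proof (rule ccontr)
    assume "2 * a \<noteq> m"
    \<comment> \<open>Now \<open>2 * a\<close> is itself a vertex other than \<open>m\<close>, so
      doubling applies to it again.\<close>
    then have "2 * (2 * a) \<notin> I" using dbl[OF dbl[OF a]] by simp
    moreover have "a + 2 * a \<in> I" using sum[OF a(1) dbl[OF a]] a by simp
    then have "(a + 2 * a) + a \<in> I" using add_I a by blast
    ultimately show False by (simp add: algebra_simps)
  qed
  then have "?V \<subseteq> {m, m div 2}" by (metis insert_iff nonzero_mult_div_cancel_left subsetI zero_neq_numeral)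
  then have "card ?V \<le> card {m, m div 2}" by (intro card_mono) auto
  also have "\<dots> \<le> 2" by (simp add: card_insert_if)
  finally show ?thesis using V by simp
qed simp

theorem theorem2p8:
  fixes \<Lambda> I :: "nat set" and n :: nat
  assumes "numerical_semigroup \<Lambda>"
    and "embedding_dimension \<Lambda> = n" and "n \<ge> 2"
    and "irreducible_ideal \<Lambda> I"
    and "order_of (ideal_graph \<Lambda> I) \<le> 5
      \<or> (order_of (ideal_graph \<Lambda> I) = 6 \<and> (\<exists>H\<in>{H1, H2, H3, H4}. graph_iso (ideal_graph \<Lambda> I) H))
      \<or> (order_of (ideal_graph \<Lambda> I) = 7 \<and> (\<exists>K\<in>{K1, K2, K3}. graph_iso (ideal_graph \<Lambda> I) K))"
  shows "planar (ideal_graph \<Lambda> I)"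
proof -
  let ?G = "ideal_graph \<Lambda> I"
  \<comment> \<open>An infinite set has \<open>card\<close> 0, so a bound on the order is
    informative only together with finiteness.\<close>
  have fin: "finite (verts ?G)"
    using finite_verts_ideal_graph assms(1,4) by (simp add: irreducible_ideal_def proper_ideal_def)
  have "order_of ?G \<le> 5 \<or> (\<exists>H\<in>{H1, H2, H3, H4} \<union> {K1, K2, K3}. graph_iso ?G H)"
    using assms(5) by (simp only: bex_Un) argo
  then show ?thesis
  proof (elim disjE bexE)
    assume "order_of ?G \<le> 5"
    then show ?thesis
    proof (rule planar_order_le_5[OF fin _ edges_ideal_graph])
      assume "order_of ?G = 5"
      \<comment> \<open>A complete graph would have order at most 2, so order 5 yields the
        nonadjacent pair.\<close>
      then have "\<not> order_of ?G \<le> 2" by simp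
      then show "\<exists>u\<in>verts ?G. \<exists>v\<in>verts ?G. u \<noteq> v \<and> {u, v} \<notin> edges ?G"
        using complete_irreducible_ideal_graph_order_le_2[OF assms(1,4)] by blast
    qed
  next
    fix H assume H: "H \<in> {H1, H2, H3, H4} \<union> {K1, K2, K3}" and iso: "graph_iso ?G H"
    have "planar H"
      using H planar_H1 planar_H2 planar_H3 planar_H4 planar_K1 planar_K2 planar_K3 by auto
    then show ?thesis using iso edges_ideal_graph by (rule planar_graph_iso)
  qed
qed

end
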